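(* Let $N\geq 2$ be an integer, and let $d,i$ be positive integers with $i\geq 2$ such that $N=\frac{d(d+i)}{i-1}$. Then for every $\alpha\in X_{N,d,i}$ there is some $k\in\{d,\dots,d+i-1\}$ such that $T_{\alpha}^2(\alpha)\in I_k$ and $T_{\alpha}^2(\alpha+1)\in I_{k+1}$. Moreover, $T_{\alpha}^{3}(\alpha)=T_{\alpha}^{3}(\alpha+1)$.
   Context: For an integer $N\ge 2$ and a real $\alpha$ with $0<\alpha\le\sqrt N-1$, put $I_\alpha=[\alpha,\alpha+1]$ and define $T_\alpha:I_\alpha\to[\alpha,\alpha+1)$ by $T_\alpha(x)=\frac Nx-d(x)$, where $d(x)=\lfloor \frac Nx-\alpha\rfloor$ (the dependence on $N$ is suppressed). The values of $d(\cdot)$ are the digits; they form a finite set of consecutive integers $\{d,d+1,\dots,d+i\}$ with smallest digit $d=d(\alpha+1)$ and largest digit $d+i$. The cylinders are $I_k=\{x\in I_\alpha : d(x)=k\}$; the largest digit is always chosen so that every cylinder is an interval (in the exceptional case that $N/\alpha-\alpha$ is an integer, the single point $\alpha$ is given the digit $N/\alpha-\alpha-1$, so that $T_\alpha(\alpha)=\alpha+1$). The interior of $I_k$ is denoted $I_k^{o}$. For positive integers $d,i$, let $\mathcal A_{N,d,i}$ be the set of all $\alpha\in(0,\sqrt N-1]$ for which $T_\alpha$ has digit set $\{d,d+1,\dots,d+i\}$, and let $X_{N,d,i}=\{\alpha\in\mathcal A_{N,d,i} : T_\alpha(\alpha)\in I_d^{o},\ T_\alpha(\alpha+1)\in I_{d+i}^{o}\}$.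 *)

theory Defs
  imports "HOL-Analysis.Analysis"
begin

(* The first branch is the convention at the left endpoint: if N / alpha - alpha is an integer,
   the floor formula would give the point alpha a one-point cylinder of its own; instead alpha is
   put into the adjacent cylinder, and then T_alpha(alpha) = alpha + 1.
   Meaningful for x in [alpha, alpha + 1] with alpha > 0. *)
definition digit :: "int \<Rightarrow> real \<Rightarrow> real \<Rightarrow> int" where
  "digit N \<alpha> x =
     (if x = \<alpha> \<and> of_int N / \<alpha> - \<alpha> \<in> \<int> then \<lfloor>of_int N / \<alpha> - \<alpha>\<rfloor> - 1
      else \<lfloor>of_int N / x - \<alpha>\<rfloor>)"

definition cf_map :: "int \<Rightarrow> real \<Rightarrow> real \<Rightarrow> real" where
  "cf_map N \<alpha> x = of_int N / x - of_int (digit N \<alpha> x)"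

definition cylinder :: "int \<Rightarrow> real \<Rightarrow> int \<Rightarrow> real set" where
  "cylinder N \<alpha> k = {x \<in> {\<alpha>..\<alpha> + 1}. digit N \<alpha> x = k}"

definition digit_params :: "int \<Rightarrow> int \<Rightarrow> int \<Rightarrow> real set" where
  "digit_params N d i =
     {\<alpha>. 0 < \<alpha> \<and> \<alpha> \<le> sqrt (of_int N) - 1 \<and> digit N \<alpha> ` {\<alpha>..\<alpha> + 1} = {d..d + i}}"

(* Interiors are taken in the real line, so they contain neither alpha nor alpha + 1. *)
definition matching_params :: "int \<Rightarrow> int \<Rightarrow> int \<Rightarrow> real set" where
  "matching_params N d i =
     {\<alpha> \<in> digit_params N d i.
        cf_map N \<alpha> \<alpha> \<in> interior (cylinder N \<alpha> d) \<and>
        cf_map N \<alpha> (\<alpha> + 1) \<in> interior (cylinder N \<alpha> (d + i))}"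

end

theory Submission
  imports Defs
begin

text \<open>
  Write \<open>e = d + i\<close>. The digit function decreases along the interval, so \<open>\<alpha>\<close> has the largest
  digit \<open>e\<close> and \<open>\<alpha> + 1\<close> the smallest digit \<open>d\<close>; the two interior conditions say that the second
  digits are \<open>d\<close> and \<open>e\<close>, in the opposite order. Hence the second iterates \<open>p\<close> of \<open>\<alpha>\<close> and \<open>q\<close> of
  \<open>\<alpha> + 1\<close> are explicit Moebius functions of \<open>\<alpha>\<close>. The relation \<open>N (i - 1) = d e\<close> is exactly what
  gives them the common numerator \<open>N (i \<alpha> - d)\<close>, over the denominators \<open>N - e \<alpha>\<close> and
  \<open>N - d (\<alpha> + 1)\<close>. These denominators differ by \<open>i \<alpha> - d\<close>, so \<open>N / q = N / p + 1\<close>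
  (lemma \<open>divide_second_iterates\<close>).

  Therefore \<open>p\<close> and \<open>q\<close> have consecutive digits, and subtracting these digits cancels the
  difference 1, which gives equal third iterates. The one way this could fail is the exceptional
  digit at \<open>\<alpha>\<close>; but in the exceptional case \<open>\<alpha>\<close> is mapped to the endpoint \<open>\<alpha> + 1\<close>, which lies in
  no cylinder's interior.
\<close>

lemma digit_eq_floor:
  assumes "of_int N / \<alpha> - \<alpha> \<notin> \<int>"
  shows "digit N \<alpha> x = \<lfloor>of_int N / x - \<alpha>\<rfloor>"
  using assms by (simp add: digit_def)

lemma digit_antimono:
  assumes "of_int N / \<alpha> - \<alpha> \<notin> \<int>" "0 \<le> N" "0 < x" "x \<le> y"
  shows "digit N \<alpha> y \<le> digit N \<alpha> x"
proof -
  have "real_of_int N / y \<le> real_of_int N / x"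
    using assms(2-4) by (intro divide_left_mono) auto
  then show ?thesis
    by (simp add: digit_eq_floor[OF assms(1)] floor_mono)
qed

lemma cf_map_bounds:
  assumes "of_int N / \<alpha> - \<alpha> \<notin> \<int>"
  shows "\<alpha> \<le> cf_map N \<alpha> x" "cf_map N \<alpha> x < \<alpha> + 1"
  unfolding cf_map_def digit_eq_floor[OF assms] by linarith+

lemma interior_cylinder_subset: "interior (cylinder N \<alpha> k) \<subseteq> cylinder N \<alpha> k \<inter> {\<alpha><..<\<alpha> + 1}"
proof -
  have "interior (cylinder N \<alpha> k) \<subseteq> interior {\<alpha>..\<alpha> + 1}"
    by (intro interior_mono) (auto simp: cylinder_def)
  then show ?thesis
    using interior_subset[of "cylinder N \<alpha> k"] by auto
qed

lemma cf_map_left_endpoint_exceptional: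
  assumes "of_int N / \<alpha> - \<alpha> \<in> \<int>"
  shows "cf_map N \<alpha> \<alpha> = \<alpha> + 1"
proof -
  have "of_int \<lfloor>of_int N / \<alpha> - \<alpha>\<rfloor> = of_int N / \<alpha> - \<alpha>"
    using assms by (rule of_int_floor)
  then show ?thesis
    using assms by (simp add: cf_map_def digit_def)
qed

text \<open>
  The common numerator \<open>n (i a - d)\<close> of \<open>p\<close> and \<open>q\<close> vanishes exactly when \<open>p = 0\<close>, so \<open>p \<noteq> 0\<close> is
  what makes both reciprocals meaningful; they then share the denominator \<open>i a - d\<close>, which is
  also the difference of their numerators.
\<close>

lemma divide_second_iterates:
  fixes n a d i u v p q :: "'a :: field"
  assumes nz: "n \<noteq> 0" "a \<noteq> 0" "a + 1 \<noteq> 0" "u \<noteq> 0" "v \<noteq> 0" "p \<noteq> 0"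
    and rel: "n * (i - 1) = d * (d + i)"
    and u: "u = n / a - (d + i)" and v: "v = n / (a + 1) - d"
    and p: "p = n / u - d" and q: "q = n / v - (d + i)"
  shows "n / q = n / p + 1"
proof -
  define m where "m = i * a - d"
  have ua: "u * a = n - (d + i) * a"
    using nz by (simp add: u field_simps)
  have va: "v * (a + 1) = n - d * (a + 1)"
    unfolding v left_diff_distrib using nz by simp
  have "p * (u * a) = n * a - d * (u * a)"
    using nz by (simp add: p left_diff_distrib)
  also have "\<dots> = n * a - d * n + d * (d + i) * a"
    unfolding ua by (simp add: algebra_simps)
  also have "\<dots> = n * m"
    unfolding m_def using rel by algebra
  finally have pm: "p * (u * a) = n * m" .
  have "q * (v * (a + 1)) = n * (a + 1) - (d + i) * (v * (a + 1))"
    using nz by (simp add: q left_diff_distrib)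
  also have "\<dots> = n * (a + 1) - (d + i) * n + d * (d + i) * (a + 1)"
    unfolding va by (simp add: algebra_simps)
  also have "\<dots> = n * m"
    unfolding m_def using rel by algebra
  finally have qm: "q * (v * (a + 1)) = n * m" .
  have m: "m \<noteq> 0"
    using pm nz by auto
  then have "q \<noteq> 0"
    using qm nz by auto
  have "n / p = u * a / m"
    using pm nz m by (simp add: frac_eq_eq mult.commute)
  moreover have "n / q = v * (a + 1) / m"
    using qm \<open>q \<noteq> 0\<close> m by (simp add: frac_eq_eq mult.commute)
  moreover have "v * (a + 1) = u * a + m"
    unfolding ua va m_def by (simp add: algebra_simps)
  ultimately show ?thesis
    using m by (simp add: add_divide_distrib)
qed

theorem theorem3:
  fixes N d i :: int and \<alpha> :: real
  assumes "N \<ge> 2" and "d \<ge> 1" and "i \<ge> 2"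
    and "real_of_int N = real_of_int (d * (d + i)) / real_of_int (i - 1)"
    and "\<alpha> \<in> matching_params N d i"
  shows "(\<exists>k\<in>{d..d + i - 1}.
            (cf_map N \<alpha> ^^ 2) \<alpha> \<in> cylinder N \<alpha> k \<and>
            (cf_map N \<alpha> ^^ 2) (\<alpha> + 1) \<in> cylinder N \<alpha> (k + 1))
         \<and> (cf_map N \<alpha> ^^ 3) \<alpha> = (cf_map N \<alpha> ^^ 3) (\<alpha> + 1)"
proof -
  let ?T = "cf_map N \<alpha>"
  define u v where "u = ?T \<alpha>" and "v = ?T (\<alpha> + 1)"
  define p q where "p = ?T u" and "q = ?T v"
  have pos: "0 < \<alpha>" and digits: "digit N \<alpha> ` {\<alpha>..\<alpha> + 1} = {d..d + i}"
    and u_int: "u \<in> interior (cylinder N \<alpha> d)"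
    and v_int: "v \<in> interior (cylinder N \<alpha> (d + i))"
    using assms(5) by (auto simp: matching_params_def digit_params_def u_def v_def)
  have u: "\<alpha> < u" "u < \<alpha> + 1" "digit N \<alpha> u = d"
    using u_int interior_cylinder_subset[of N \<alpha> d] by (auto simp: cylinder_def)
  have v: "\<alpha> < v" "digit N \<alpha> v = d + i"
    using v_int interior_cylinder_subset[of N \<alpha> "d + i"] by (auto simp: cylinder_def)
  have regular: "of_int N / \<alpha> - \<alpha> \<notin> \<int>"
    using cf_map_left_endpoint_exceptional[of N \<alpha>] u(2) by (auto simp: u_def)
  have extremal: "digit N \<alpha> (\<alpha> + 1) \<le> digit N \<alpha> x \<and> digit N \<alpha> x \<le> digit N \<alpha> \<alpha>"
    if "x \<in> {\<alpha>..\<alpha> + 1}" for x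
    using that pos assms(1) by (auto intro!: digit_antimono[OF regular])
  have digit_range: "digit N \<alpha> x \<in> {d..d + i}" if "x \<in> {\<alpha>..\<alpha> + 1}" for x
    using that digits by blast
  have "digit N \<alpha> \<alpha> = d + i"
    using extremal[of v] v digit_range[of \<alpha>] v_int interior_cylinder_subset[of N \<alpha> "d + i"]
    by (force simp: cylinder_def)
  then have u_eq: "u = of_int N / \<alpha> - (of_int d + of_int i)"
    by (simp add: u_def cf_map_def)
  have "digit N \<alpha> (\<alpha> + 1) = d"
    using extremal[of u] u digit_range[of "\<alpha> + 1"] by force
  then have v_eq: "v = of_int N / (\<alpha> + 1) - of_int d"
    by (simp add: v_def cf_map_def)
  have p_eq: "p = of_int N / u - of_int d"
    using u by (simp add: p_def cf_map_def)
  have q_eq: "q = of_int N / v - (of_int d + of_int i)"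
    using v by (simp add: q_def cf_map_def)
  have p_mem: "p \<in> {\<alpha>..\<alpha> + 1}" and q_mem: "q \<in> {\<alpha>..\<alpha> + 1}"
    using cf_map_bounds[OF regular] by (auto simp: p_def q_def less_imp_le)
  have rel: "real_of_int N * (of_int i - 1) = of_int d * (of_int d + of_int i)"
    using assms(3,4) by (simp add: field_simps)
  have shift: "of_int N / q = of_int N / p + 1"
    by (rule divide_second_iterates[OF _ _ _ _ _ _ rel u_eq v_eq p_eq q_eq])
      (use assms(1) pos u(1) v(1) p_mem in auto)
  have "of_int N / q - \<alpha> = (of_int N / p - \<alpha>) + 1"
    using shift by simp
  then have digit_q: "digit N \<alpha> q = digit N \<alpha> p + 1"
    unfolding digit_eq_floor[OF regular] by linarith
  have "digit N \<alpha> p \<in> {d..d + i - 1}"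
    using digit_range[OF p_mem] digit_range[OF q_mem] digit_q by auto
  moreover have "p \<in> cylinder N \<alpha> (digit N \<alpha> p)" "q \<in> cylinder N \<alpha> (digit N \<alpha> p + 1)"
    using p_mem q_mem digit_q by (auto simp: cylinder_def)
  moreover have "?T p = ?T q"
    by (simp add: cf_map_def digit_q shift)
  moreover have "(?T ^^ 2) \<alpha> = p" "(?T ^^ 2) (\<alpha> + 1) = q"
    "(?T ^^ 3) \<alpha> = ?T p" "(?T ^^ 3) (\<alpha> + 1) = ?T q"
    by (simp_all add: numeral_eq_Suc p_def q_def u_def v_def)
  ultimately show ?thesis
    by auto
qed

end
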